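(* In the setting of the context, consider the dual-averaging update $$\lambda_{k+1}=(1-t_k)\lambda_k+t_k\nabla f(z_k),\qquad z_{k+1}=z^{\eta_{k+1}}(\lambda_{k+1}),\qquad k\ge0,$$ initialized with $\eta_0=0$, $\lambda_0=0$, $z_0=x_0$, and using $$t_k=\frac{\mu+\eta_k^{-1}}{L+\eta_k^{-1}},\qquad \eta_{k+1}^{-1}=(1-t_k)\eta_k^{-1},$$ where at $k=0$ these formulas are understood in the limit $\eta_0^{-1}\to+\infty$, i.e. $t_0=1$ and $\eta_1^{-1}=L-\mu$. Then the points $x_k\in\arg\min\{\phi(x):x\in\{z_1,\dots,z_k\}\}$, $k\ge1$, satisfy the implicit envelope descent scheme with the parameters $\eta_k$, i.e. $\eta_{k+1}\ge\eta_k$ for $k\ge0$ and $\phi(x_k)\le\phi_\star^{\eta_k}$ for every $k\ge1$; moreover, for every $k\ge1$, $$\eta_k^{-1}\le L\min\left\{\frac1k,\ \frac{\kappa}{(1+\kappa)^k-1}\right\},\qquad\kappa=\frac\mu L,$$ where the second term is omitted when $\mu=0$.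
   Context: Setting. $d:\mathbb R^n\to\mathbb R\cup\{+\infty\}$ is a Legendre function: proper, closed, convex, differentiable on $\operatorname{int}(\operatorname{dom} d)$ with $\|\nabla d(u_j)\|\to\infty$ whenever $u_j$ tends to a boundary point of $\operatorname{dom} d$, and strictly convex on every convex subset of $\operatorname{dom}\partial d$; $d^*$ is its Fenchel conjugate, and $\nabla d:\operatorname{int}(\operatorname{dom} d)\to\operatorname{int}(\operatorname{dom} d^* )$ is a bijection with inverse $\nabla d^*$. $D_d(x,y)=d(x)-d(y)-\langle\nabla d(y),x-y\rangle$. $\mathcal X=\operatorname{cl}(\operatorname{dom} d)$, $x_0\in\operatorname{int}(\operatorname{dom} d)$. $f:\mathcal X\to\mathbb R$ is convex, differentiable, and relatively $(L-\mu)$-smooth with respect to $d$, i.e. $f(x)-f(y)-\langle\nabla f(y),x-y\rangle\le(L-\mu)D_d(x,y)$ for $x,y\in\operatorname{int}(\mathcal X)$, with $0\le\mu<L$. The objective is $\phi(x)=f(x)+\mu D_d(x,x_0)$. Standing convention: the minimizers of $\phi$ and of the subproblems exist and are interior; in particular the points $z_k$ are well defined in $\operatorname{int}(\operatorname{dom} d)$. For $\eta>0$: $\phi^\eta(x)=\phi(x)+\frac1\eta D_d(x,x_0)$, $\phi_\star^\eta=\min_x\phi^\eta(x)$, and $$z^\eta(\lambda)=\arg\min_x\left\{\langle x,\lambda\rangle+(\mu+\eta^{-1})D_d(x,x_0)\right\}=\nabla d^*\left(\nabla d(x_0)-\frac{\lambda}{\mu+\eta^{-1}}\right).$$ The implicit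 envelope descent scheme: starting from $\eta_0=0$, for each $k\ge0$ choose $\eta_{k+1}\ge\eta_k$ and find $x_{k+1}$ with $\phi(x_{k+1})\le\phi_\star^{\eta_{k+1}}$. *)

theory Defs
  imports "HOL-Analysis.Analysis"
begin

text \<open>Functions with values in the reals extended by \<open>+\<infinity>\<close> are modelled as \<open>ereal\<close>-valued functions
  on the whole space; properness excludes \<open>-\<infinity>\<close>.\<close>

definition effdom :: "('a \<Rightarrow> ereal) \<Rightarrow> 'a set"
  where "effdom d = {x. d x < \<infinity>}"

definition epi :: "('a \<Rightarrow> ereal) \<Rightarrow> ('a \<times> real) set"
  where "epi d = {(x, r). d x \<le> ereal r}"

definition proper_fun :: "('a \<Rightarrow> ereal) \<Rightarrow> bool"
  where "proper_fun d \<longleftrightarrow> effdom d \<noteq> {} \<and> (\<forall>x. d x \<noteq> -\<infinity>)"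

definition closed_fun :: "('a::euclidean_space \<Rightarrow> ereal) \<Rightarrow> bool"
  where "closed_fun d \<longleftrightarrow> closed (epi d)"

definition convex_fun :: "('a::euclidean_space \<Rightarrow> ereal) \<Rightarrow> bool"
  where "convex_fun d \<longleftrightarrow> convex (epi d)"

text \<open>Unspecified at points where \<open>f\<close> is not differentiable.\<close>

definition grad :: "('a::euclidean_space \<Rightarrow> real) \<Rightarrow> 'a \<Rightarrow> 'a"
  where "grad f x = (THE g. GDERIV f x :> g)"

text \<open>Only meaningful in the interior of the effective domain, where \<open>d\<close> is finite near \<open>x\<close>.\<close>

definition egrad :: "('a::euclidean_space \<Rightarrow> ereal) \<Rightarrow> 'a \<Rightarrow> 'a"
  where "egrad d = grad (\<lambda>x. real_of_ereal (d x))"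

definition subdiff :: "('a::euclidean_space \<Rightarrow> ereal) \<Rightarrow> 'a \<Rightarrow> 'a set"
  where "subdiff d x = {g. \<forall>y. d x + ereal (g \<bullet> (y - x)) \<le> d y}"

definition strictly_convex_fun_on :: "'a::euclidean_space set \<Rightarrow> ('a \<Rightarrow> ereal) \<Rightarrow> bool"
  where "strictly_convex_fun_on C d \<longleftrightarrow>
    (\<forall>x\<in>C. \<forall>y\<in>C. \<forall>s. x \<noteq> y \<and> 0 < s \<and> s < 1 \<longrightarrow>
       d ((1 - s) *\<^sub>R x + s *\<^sub>R y) < ereal (1 - s) * d x + ereal s * d y)"

definition legendre :: "('a::euclidean_space \<Rightarrow> ereal) \<Rightarrow> bool"
  where "legendre d \<longleftrightarrow>
    proper_fun d \<and> closed_fun d \<and> convex_fun d \<and>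
    (\<forall>x\<in>interior (effdom d). (\<lambda>y. real_of_ereal (d y)) differentiable (at x)) \<and>
    (\<forall>u b. (\<forall>j. u j \<in> interior (effdom d)) \<and> b \<in> frontier (effdom d) \<and> u \<longlonglongrightarrow> b \<longrightarrow>
       filterlim (\<lambda>j::nat. norm (egrad d (u j))) at_top sequentially) \<and>
    (\<forall>C. convex C \<and> C \<subseteq> {x. subdiff d x \<noteq> {}} \<longrightarrow> strictly_convex_fun_on C d)"

text \<open>The Bregman distance is used only for \<open>y\<close> in the interior of the effective domain; it is \<open>\<infinity>\<close>
  exactly when \<open>x\<close> lies outside the effective domain.\<close>

definition bregman :: "('a::euclidean_space \<Rightarrow> ereal) \<Rightarrow> 'a \<Rightarrow> 'a \<Rightarrow> ereal"
  where "bregman d x y = d x - d y - ereal (egrad d y \<bullet> (x - y))"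

definition relatively_smooth ::
    "('a::euclidean_space \<Rightarrow> ereal) \<Rightarrow> real \<Rightarrow> ('a \<Rightarrow> real) \<Rightarrow> bool"
  where "relatively_smooth d M f \<longleftrightarrow>
    (\<forall>x\<in>interior (closure (effdom d)). \<forall>y\<in>interior (closure (effdom d)).
       ereal (f x - f y - grad f y \<bullet> (x - y)) \<le> ereal M * bregman d x y)"

text \<open>The function \<open>f\<close> lives on \<open>closure (effdom d)\<close>; its values elsewhere are irrelevant, and the
  objective is \<open>\<infinity>\<close> there. When \<open>\<mu> = 0\<close> the library convention \<open>0 * \<infinity> = 0\<close> makes the objective equal
  to \<open>f\<close> on all of \<open>closure (effdom d)\<close>.\<close>

definition objective ::
    "('a::euclidean_space \<Rightarrow> ereal) \<Rightarrow> ('a \<Rightarrow> real) \<Rightarrow> real \<Rightarrow> 'a \<Rightarrow> 'a \<Rightarrow> ereal"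
  where "objective d f \<mu> x0 x =
    (if x \<in> closure (effdom d) then ereal (f x) + ereal \<mu> * bregman d x x0 else \<infinity>)"

text \<open>Meaningful for \<open>\<eta> > 0\<close> only.\<close>

definition reg_objective ::
    "('a::euclidean_space \<Rightarrow> ereal) \<Rightarrow> ('a \<Rightarrow> real) \<Rightarrow> real \<Rightarrow> 'a \<Rightarrow> real \<Rightarrow> 'a \<Rightarrow> ereal"
  where "reg_objective d f \<mu> x0 \<eta> x = objective d f \<mu> x0 x + ereal (1 / \<eta>) * bregman d x x0"

definition envelope ::
    "('a::euclidean_space \<Rightarrow> ereal) \<Rightarrow> ('a \<Rightarrow> real) \<Rightarrow> real \<Rightarrow> 'a \<Rightarrow> real \<Rightarrow> ereal"
  where "envelope d f \<mu> x0 \<eta> = (INF x. reg_objective d f \<mu> x0 \<eta> x)"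

definition is_minimizer :: "('a \<Rightarrow> ereal) \<Rightarrow> 'a \<Rightarrow> bool"
  where "is_minimizer g x \<longleftrightarrow> is_arg_min g (\<lambda>_. True) x"

text \<open>The function minimized in the definition of \<open>z\<^sup>\<eta>(\<lambda>)\<close>.\<close>

definition dual_model ::
    "('a::euclidean_space \<Rightarrow> ereal) \<Rightarrow> real \<Rightarrow> 'a \<Rightarrow> real \<Rightarrow> 'a \<Rightarrow> 'a \<Rightarrow> ereal"
  where "dual_model d \<mu> x0 \<eta> lam x =
    ereal (x \<bullet> lam) + ereal (\<mu> + 1 / \<eta>) * bregman d x x0"

text \<open>The positivity of \<open>\<eta> (Suc k)\<close> is what makes the regularized objective meaningful.\<close>

definition implicit_envelope_descent ::
    "('a::euclidean_space \<Rightarrow> ereal) \<Rightarrow> ('a \<Rightarrow> real) \<Rightarrow> real \<Rightarrow> 'a \<Rightarrow> (nat \<Rightarrow> real) \<Rightarrow> (nat \<Rightarrow> 'a) \<Rightarrow> bool"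
  where "implicit_envelope_descent d f \<mu> x0 \<eta> x \<longleftrightarrow>
    \<eta> 0 = 0 \<and>
    (\<forall>k. \<eta> k \<le> \<eta> (Suc k) \<and> 0 < \<eta> (Suc k) \<and>
         objective d f \<mu> x0 (x (Suc k)) \<le> envelope d f \<mu> x0 (\<eta> (Suc k)))"

end

theory Submission
  imports Defs
begin

text \<open>Averaging the linearizations of \<open>f\<close> at \<open>z\<^sub>0, \<dots>, z\<^sub>k\<^sub>-\<^sub>1\<close> with the weights produced by the \<open>t\<^sub>i\<close> gives
  an affine minorant \<open>\<ell>\<^sub>k\<close> of \<open>f\<close> with slope \<open>\<lambda>\<^sub>k\<close>. With \<open>a\<^sub>k = \<mu> + 1/\<eta>\<^sub>k\<close>, the model
  \<open>m\<^sub>k = \<ell>\<^sub>k + a\<^sub>k D\<^sub>d(\<cdot>, x\<^sub>0)\<close> minorizes \<open>\<phi>\<^sup>\<eta>\<close> at \<open>\<eta> = \<eta>\<^sub>k\<close>, is minimized at \<open>z\<^sub>k\<close>, and satisfies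
  \<open>m\<^sub>k(x) = m\<^sub>k(z\<^sub>k) + a\<^sub>k D\<^sub>d(x, z\<^sub>k)\<close>. The choice of \<open>t\<^sub>k\<close> yields \<open>a\<^sub>k\<^sub>+\<^sub>1 = (1 - t\<^sub>k) a\<^sub>k + t\<^sub>k \<mu>\<close> and
  \<open>(1 - t\<^sub>k) a\<^sub>k = t\<^sub>k (L - \<mu>)\<close>, so relative smoothness gives
  \<open>m\<^sub>k\<^sub>+\<^sub>1(z\<^sub>k\<^sub>+\<^sub>1) \<ge> (1 - t\<^sub>k) m\<^sub>k(z\<^sub>k) + t\<^sub>k \<phi>(z\<^sub>k\<^sub>+\<^sub>1)\<close>. Hence \<open>min m\<^sub>k\<close> dominates a weighted average of
  \<open>\<phi>(z\<^sub>1), \<dots>, \<phi>(z\<^sub>k)\<close>. The rate follows from \<open>\<eta>\<^sub>k\<^sub>+\<^sub>1 = (L \<eta>\<^sub>k + 1) / (L - \<mu>)\<close>.\<close>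

section \<open>Gradients, first-order convexity and real-valued Bregman distances\<close>

lemma GDERIV_grad:
  assumes "f differentiable (at x)"
  shows "GDERIV f x :> grad f x"
proof -
  obtain f' where f': "(f has_derivative f') (at x)"
    using assms unfolding differentiable_def by blast
  then interpret bounded_linear f' by (rule has_derivative_bounded_linear)
  have "f' = (\<lambda>h. h \<bullet> (\<Sum>b\<in>Basis. f' b *\<^sub>R b))"
  proof
    fix h
    have "f' h = f' (\<Sum>b\<in>Basis. (h \<bullet> b) *\<^sub>R b)" by (simp add: euclidean_representation)
    also have "\<dots> = h \<bullet> (\<Sum>b\<in>Basis. f' b *\<^sub>R b)"
      by (simp add: sum scaleR inner_sum_right mult.commute)
    finally show "f' h = h \<bullet> (\<Sum>b\<in>Basis. f' b *\<^sub>R b)" .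
  qed
  with f' have ex: "GDERIV f x :> (\<Sum>b\<in>Basis. f' b *\<^sub>R b)"
    unfolding gderiv_def by simp
  \<comment> \<open>Uniqueness matters because \<open>grad\<close> is a definite
    description.\<close>
  have "g = g'" if "GDERIV f x :> g" "GDERIV f x :> g'" for g g'
  proof -
    have "(\<lambda>h. h \<bullet> g) = (\<lambda>h. h \<bullet> g')"
      using that has_derivative_unique unfolding gderiv_def by blast
    then show ?thesis by (metis inner_commute vector_eq_rdot)
  qed
  with ex show ?thesis
    unfolding grad_def by (metis (no_types, lifting) theI)
qed

text \<open>Along the segment from \<open>y\<close> to \<open>x\<close>, convexity bounds every
  forward difference quotient by \<open>f x - f y\<close>, and these quotients tend to the
  directional derivative at \<open>y\<close>.\<close>

lemma convex_on_grad_ineq: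
  assumes "convex_on S f" "x \<in> S" "y \<in> S" "f differentiable (at y)"
  shows "f y + grad f y \<bullet> (x - y) \<le> f x"
proof -
  let ?h = "x - y"
  let ?F = "\<lambda>s. f (y + s *\<^sub>R ?h)"
  have fd: "(f has_derivative (\<lambda>h. h \<bullet> grad f y)) (at (y + 0 *\<^sub>R ?h))"
    using GDERIV_grad[OF assms(4)] by (simp add: gderiv_def)
  have "((\<lambda>s::real. y + s *\<^sub>R ?h) has_derivative (\<lambda>s. s *\<^sub>R ?h)) (at 0)"
    by (auto intro!: derivative_eq_intros)
  from has_derivative_compose[OF this fd]
  have "(?F has_real_derivative grad f y \<bullet> ?h) (at 0)"
    unfolding has_field_derivative_def
    by (simp add: inner_commute mult.commute[of _ "grad f y \<bullet> ?h"])
  then have "((\<lambda>s. (?F s - f y) / s) \<longlongrightarrow> grad f y \<bullet> ?h) (at_right 0)"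
    by (auto simp: DERIV_def intro: tendsto_within_subset)
  moreover have "\<forall>\<^sub>F s in at_right (0::real). (?F s - f y) / s \<le> f x - f y"
    unfolding eventually_at_right_field
  proof (intro exI conjI allI impI)
    show "(0::real) < 1" by simp
    fix s :: real assume s: "0 < s" "s < 1"
    have "f ((1 - s) *\<^sub>R y + s *\<^sub>R x) \<le> (1 - s) * f y + s * f x"
      using s convex_onD[OF assms(1), of s y x] assms(2,3) by simp
    moreover have "(1 - s) *\<^sub>R y + s *\<^sub>R x = y + s *\<^sub>R ?h" by (simp add: algebra_simps)
    ultimately have "?F s - f y \<le> (f x - f y) * s" by (simp add: algebra_simps)
    with s show "(?F s - f y) / s \<le> f x - f y" by (simp add: pos_divide_le_eq)
  qed
  ultimately have "grad f y \<bullet> ?h \<le> f x - f y"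
    by (intro tendsto_upperbound[where F = "at_right 0"]) auto
  then show ?thesis by simp
qed

text \<open>Keeps the arithmetic in the reals. For proper \<open>d\<close> it agrees with
  \<open>bregman\<close> when both points lie in the effective domain; elsewhere its value is an
  artefact of \<open>real_of_ereal\<close>.\<close>

definition real_bregman :: "('a::euclidean_space \<Rightarrow> ereal) \<Rightarrow> 'a \<Rightarrow> 'a \<Rightarrow> real"
  where "real_bregman d x y =
    real_of_ereal (d x) - real_of_ereal (d y) - egrad d y \<bullet> (x - y)"

lemma proper_fun_finite:
  assumes "proper_fun d" "x \<in> effdom d"
  shows "d x = ereal (real_of_ereal (d x))"
  using assms by (cases "d x") (auto simp: proper_fun_def effdom_def)

lemma bregman_eq:
  assumes "proper_fun d" "x \<in> effdom d" "y \<in> effdom d"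
  shows "bregman d x y = ereal (real_bregman d x y)"
proof -
  obtain a b where "d x = ereal a" "d y = ereal b"
    using proper_fun_finite assms by metis
  then show ?thesis by (simp add: bregman_def real_bregman_def)
qed

lemma bregman_infinity:
  assumes "proper_fun d" "x \<notin> effdom d" "y \<in> effdom d"
  shows "bregman d x y = \<infinity>"
proof -
  obtain b where "d y = ereal b"
    using proper_fun_finite assms by metis
  with assms(2) show ?thesis by (simp add: bregman_def effdom_def)
qed

text \<open>Moves the centre from \<open>y\<close> to \<open>z\<close>; the cross term is what
  stationarity at \<open>z\<close> cancels against the slope of the dual model.\<close>

lemma three_point_real_bregman:
  "real_bregman d x y
    = real_bregman d z y + (egrad d z - egrad d y) \<bullet> (x - z) + real_bregman d x z"
  by (simp add: real_bregman_def inner_simps)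

lemma real_bregman_GDERIV:
  assumes "(\<lambda>y. real_of_ereal (d y)) differentiable (at z)"
  shows "GDERIV (\<lambda>x. real_bregman d x y) z :> egrad d z - egrad d y"
proof -
  have "((\<lambda>x. real_of_ereal (d x)) has_derivative (\<lambda>h. h \<bullet> egrad d z)) (at z)"
    using GDERIV_grad[OF assms] by (simp add: gderiv_def egrad_def)
  then show ?thesis
    unfolding gderiv_def real_bregman_def
    by (auto intro!: derivative_eq_intros simp: inner_simps inner_commute)
qed

section \<open>Objectives and dual models as real expressions on the domain\<close>

lemma objective_eq:
  assumes "proper_fun d" "x \<in> effdom d" "x0 \<in> effdom d"
  shows "objective d f \<mu> x0 x = ereal (f x + \<mu> * real_bregman d x x0)"
  using assms closure_subset by (auto simp: objective_def bregman_eq)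

lemma reg_objective_eq:
  assumes "proper_fun d" "x \<in> effdom d" "x0 \<in> effdom d"
  shows "reg_objective d f \<mu> x0 \<eta> x = ereal (f x + (\<mu> + 1 / \<eta>) * real_bregman d x x0)"
  using assms by (simp add: reg_objective_def objective_eq bregman_eq algebra_simps)

text \<open>For \<open>\<mu> = 0\<close> the objective is finite at points of the closure outside
  the domain; the positive weight \<open>1 / \<eta>\<close> is what forces infinity there.\<close>

lemma reg_objective_infinity:
  assumes "proper_fun d" "x \<notin> effdom d" "x0 \<in> effdom d" "0 \<le> \<mu>" "0 < \<eta>"
  shows "reg_objective d f \<mu> x0 \<eta> x = \<infinity>"
  using assms by (auto simp: reg_objective_def objective_def bregman_infinity)

lemma dual_model_eq:
  assumes "proper_fun d" "x \<in> effdom d" "x0 \<in> effdom d"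
  shows "dual_model d \<mu> x0 \<eta> l x = ereal (x \<bullet> l + (\<mu> + 1 / \<eta>) * real_bregman d x x0)"
  using assms by (simp add: dual_model_def bregman_eq)

lemma dual_model_minimizer:
  assumes "proper_fun d" "x0 \<in> effdom d" "x \<in> effdom d" "z \<in> effdom d"
    and "is_minimizer (dual_model d \<mu> x0 \<eta> l) z"
  shows "z \<bullet> l + (\<mu> + 1 / \<eta>) * real_bregman d z x0
    \<le> x \<bullet> l + (\<mu> + 1 / \<eta>) * real_bregman d x x0"
proof -
  have "dual_model d \<mu> x0 \<eta> l z \<le> dual_model d \<mu> x0 \<eta> l x"
    using assms(5) by (simp add: is_minimizer_def is_arg_min_linorder)
  with assms show ?thesis by (simp add: dual_model_eq)
qed

text \<open>Stationarity at the interior minimizer removes the linear cross term of the three-point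
  identity, leaving an exact Bregman remainder.\<close>

lemma dual_model_expansion:
  assumes "legendre d" "x0 \<in> effdom d" "z \<in> interior (effdom d)"
    and "is_minimizer (dual_model d \<mu> x0 \<eta> l) z"
  shows "x \<bullet> l + (\<mu> + 1 / \<eta>) * real_bregman d x x0
    = z \<bullet> l + (\<mu> + 1 / \<eta>) * real_bregman d z x0 + (\<mu> + 1 / \<eta>) * real_bregman d x z"
proof -
  let ?a = "\<mu> + 1 / \<eta>"
  let ?q = "\<lambda>x. x \<bullet> l + ?a * real_bregman d x x0"
  let ?g = "l + ?a *\<^sub>R (egrad d z - egrad d x0)"
  have proper: "proper_fun d" and diff: "(\<lambda>y. real_of_ereal (d y)) differentiable (at z)"
    using assms by (auto simp: legendre_def)
  have "(?q has_derivative (\<lambda>h. h \<bullet> ?g)) (at z)"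
    using real_bregman_GDERIV[OF diff, of x0] unfolding gderiv_def
    by (auto intro!: derivative_eq_intros simp: inner_simps)
  moreover have "\<forall>y\<in>interior (effdom d). ?q z \<le> ?q y"
    using dual_model_minimizer[OF proper assms(2) _ _ assms(4)] assms(3) interior_subset
    by blast
  ultimately have "(\<lambda>h. h \<bullet> ?g) = (\<lambda>h. 0)"
    using differential_zero_maxmin[OF assms(3) open_interior] by blast
  then have "(x - z) \<bullet> ?g = 0" by metis
  then have "(x - z) \<bullet> l + ?a * ((egrad d z - egrad d x0) \<bullet> (x - z)) = 0"
    by (simp add: inner_add_right inner_commute)
  then show ?thesis
    unfolding three_point_real_bregman[of d x x0 z] by (simp add: inner_diff_left distrib_left)
qed

section \<open>Relative smoothness and the induction on the models\<close>

lemma relatively_smoothD: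
  assumes "relatively_smooth d M f" "proper_fun d"
    and "x \<in> interior (effdom d)" "y \<in> interior (effdom d)"
  shows "f x \<le> f y + grad f y \<bullet> (x - y) + M * real_bregman d x y"
proof -
  have "x \<in> interior (closure (effdom d))" "y \<in> interior (closure (effdom d))"
    using assms(3,4) interior_mono[OF closure_subset] by blast+
  moreover have "x \<in> effdom d" "y \<in> effdom d"
    using assms(3,4) interior_subset by blast+
  ultimately have "ereal (f x - f y - grad f y \<bullet> (x - y)) \<le> ereal (M * real_bregman d x y)"
    using assms(1,2) unfolding relatively_smooth_def by (metis bregman_eq times_ereal.simps(1))
  then show ?thesis by simp
qed

text \<open>The constant \<open>c\<close> is the intercept of the affine minorant \<open>\<ell>\<^sub>k\<close>; \<open>C\<close> stands for the least
  objective value found so far.\<close>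

lemma dual_averaging_model:
  fixes d :: "'a::euclidean_space \<Rightarrow> ereal" and lam z :: "nat \<Rightarrow> 'a" and \<eta> t :: "nat \<Rightarrow> real"
  assumes d: "legendre d" and x0: "x0 \<in> interior (effdom d)"
    and conv: "convex_on (closure (effdom d)) f"
    and diff: "\<forall>y\<in>interior (closure (effdom d)). f differentiable (at y)"
    and smooth: "relatively_smooth d (L - \<mu>) f"
    and init: "z 0 = x0" "t 0 = 1" "\<mu> + 1 / \<eta> 1 = L"
    and t: "\<And>k. 0 \<le> t k" "\<And>k. t k \<le> 1"
    and weight: "\<And>k. 1 \<le> k \<Longrightarrow> \<mu> + 1 / \<eta> (Suc k) = (1 - t k) * (\<mu> + 1 / \<eta> k) + t k * \<mu>"
    and balance: "\<And>k. 1 \<le> k \<Longrightarrow> (1 - t k) * (\<mu> + 1 / \<eta> k) = t k * (L - \<mu>)"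
    and lam: "\<And>k. lam (Suc k) = (1 - t k) *\<^sub>R lam k + t k *\<^sub>R grad f (z k)"
    and zmin: "\<And>k. is_minimizer (dual_model d \<mu> x0 (\<eta> (Suc k)) (lam (Suc k))) (z (Suc k))"
    and zint: "\<And>k. z (Suc k) \<in> interior (effdom d)"
    and k: "1 \<le> k"
  shows "\<exists>c. (\<forall>y\<in>closure (effdom d). c + y \<bullet> lam k \<le> f y) \<and>
    (\<forall>C. (\<forall>j\<in>{1..k}. C \<le> f (z j) + \<mu> * real_bregman d (z j) x0) \<longrightarrow>
      C \<le> c + z k \<bullet> lam k + (\<mu> + 1 / \<eta> k) * real_bregman d (z k) x0)"
  using k
proof (induction k rule: nat_induct_at_least)
  have proper: "proper_fun d" using d by (simp add: legendre_def)
  have zi: "z j \<in> interior (effdom d)" for j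
    using zint x0 init(1) by (cases j) auto
  have lin: "f (z j) + grad f (z j) \<bullet> (y - z j) \<le> f y" if "y \<in> closure (effdom d)" for y j
  proof (rule convex_on_grad_ineq[OF conv that])
    show "z j \<in> closure (effdom d)"
      using zi interior_subset closure_subset by blast
    show "f differentiable (at (z j))"
      using diff zi interior_mono[OF closure_subset] by blast
  qed
  have descent: "f (z (Suc j)) \<le> f (z j) + grad f (z j) \<bullet> (z (Suc j) - z j)
      + (L - \<mu>) * real_bregman d (z (Suc j)) (z j)" for j
    using relatively_smoothD[OF smooth proper zi zi] .
  {
    case base
    have lam1: "lam 1 = grad f x0" using lam[of 0] init by simp
    \<comment> \<open>Since \<open>t 0 = 1\<close>, the minorant is the linearization at
      \<open>x0\<close>. The coefficient \<open>L = (L - \<mu>) + \<mu>\<close> covers both the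
      smoothness error and the regularizer in the objective.\<close>
    let ?c = "f x0 - grad f x0 \<bullet> x0"
    have "\<forall>y\<in>closure (effdom d). ?c + y \<bullet> lam 1 \<le> f y"
      using lin[of _ 0] unfolding init(1) lam1 by (auto simp: inner_simps inner_commute algebra_simps)
    moreover have "f (z 1) + \<mu> * real_bregman d (z 1) x0
        \<le> ?c + z 1 \<bullet> lam 1 + (\<mu> + 1 / \<eta> 1) * real_bregman d (z 1) x0"
      using descent[of 0] unfolding init(3) lam1
      by (simp add: init(1) inner_simps inner_commute algebra_simps)
    ultimately show ?case by (intro exI[of _ ?c]) fastforce
  next
    case (Suc k)
    then obtain c where minor: "\<And>y. y \<in> closure (effdom d) \<Longrightarrow> c + y \<bullet> lam k \<le> f y"
      and best: "\<And>C. (\<forall>j\<in>{1..k}. C \<le> f (z j) + \<mu> * real_bregman d (z j) x0) \<Longrightarrow>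
        C \<le> c + z k \<bullet> lam k + (\<mu> + 1 / \<eta> k) * real_bregman d (z k) x0"
      by blast
    let ?z = "z (Suc k)"
    let ?a = "\<mu> + 1 / \<eta> k" and ?a' = "\<mu> + 1 / \<eta> (Suc k)"
    let ?G = "grad f (z k)"
    \<comment> \<open>Intercept of the convex combination of the old minorant and the linearization
      at \<open>z k\<close>.\<close>
    let ?c = "(1 - t k) * c + t k * (f (z k) - ?G \<bullet> z k)"
    have split: "?c + y \<bullet> lam (Suc k)
        = (1 - t k) * (c + y \<bullet> lam k) + t k * (f (z k) + ?G \<bullet> (y - z k))" for y
      unfolding lam by (simp add: inner_simps inner_commute algebra_simps)
    have "?c + y \<bullet> lam (Suc k) \<le> f y" if "y \<in> closure (effdom d)" for y
    proof -
      have "?c + y \<bullet> lam (Suc k) \<le> (1 - t k) * f y + t k * f y"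
        unfolding split using t minor[OF that] lin[OF that]
        by (intro add_mono mult_left_mono) auto
      then show ?thesis by (simp add: algebra_simps)
    qed
    moreover have "C \<le> ?c + ?z \<bullet> lam (Suc k) + ?a' * real_bregman d ?z x0"
      if C: "\<forall>j\<in>{1..Suc k}. C \<le> f (z j) + \<mu> * real_bregman d (z j) x0" for C
    proof -
      let ?m = "c + z k \<bullet> lam k + ?a * real_bregman d (z k) x0"
      \<comment> \<open>Minimality is assumed at successor indices only, so \<open>z k\<close> is
        read as \<open>z (Suc i)\<close>.\<close>
      obtain i where i: "k = Suc i" using Suc.hyps by (cases k) auto
      have expand: "?z \<bullet> lam k + ?a * real_bregman d ?z x0
          = z k \<bullet> lam k + ?a * real_bregman d (z k) x0 + ?a * real_bregman d ?z (z k)"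
        using dual_model_expansion[OF d _ zint zmin] x0 interior_subset unfolding i by blast
      \<comment> \<open>The first share of \<open>C\<close> is bounded by the induction hypothesis
        on the earlier points, the second by the objective at the new point.\<close>
      have "C = (1 - t k) * C + t k * C" by (simp add: algebra_simps)
      also have "\<dots> \<le> (1 - t k) * ?m + t k * (f ?z + \<mu> * real_bregman d ?z x0)"
        using t C best[of C] by (intro add_mono mult_left_mono) auto
      also have "\<dots> \<le> (1 - t k) * ?m + t k * (f (z k) + ?G \<bullet> (?z - z k)
          + (L - \<mu>) * real_bregman d ?z (z k) + \<mu> * real_bregman d ?z x0)"
        using t descent[of k] by (intro add_left_mono mult_left_mono) auto
      \<comment> \<open>The balance of weights trades the smoothness error for the Bregman remainder
        by which the old model at \<open>?z\<close> exceeds its minimum.\<close>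
      also have "\<dots> = (1 - t k) * (?m + ?a * real_bregman d ?z (z k))
          + t k * (f (z k) + ?G \<bullet> (?z - z k) + \<mu> * real_bregman d ?z x0)"
      proof -
        have "t k * ((L - \<mu>) * real_bregman d ?z (z k))
            = (1 - t k) * (?a * real_bregman d ?z (z k))"
          by (metis balance[OF Suc.hyps] mult.assoc)
        then show ?thesis by (simp only: distrib_left)
      qed
      also have "?m + ?a * real_bregman d ?z (z k)
          = c + ?z \<bullet> lam k + ?a * real_bregman d ?z x0"
        using expand by simp
      also have "(1 - t k) * (c + ?z \<bullet> lam k + ?a * real_bregman d ?z x0)
          + t k * (f (z k) + ?G \<bullet> (?z - z k) + \<mu> * real_bregman d ?z x0)
          = ?c + ?z \<bullet> lam (Suc k) + ((1 - t k) * ?a + t k * \<mu>) * real_bregman d ?z x0"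
        unfolding split by (simp only: distrib_left distrib_right mult.assoc add_ac)
      finally show ?thesis unfolding weight[OF Suc.hyps] .
    qed
    ultimately show ?case by (intro exI[of _ ?c]) blast
  }
qed

text \<open>Written in terms of \<open>\<eta>\<^sub>k\<close> instead of \<open>1/\<eta>\<^sub>k\<close>, the recursion covers the limit convention
  at \<open>k = 0\<close>.\<close>

lemma step_parameter_lower_bound:
  fixes \<eta> :: "nat \<Rightarrow> real"
  assumes "0 \<le> \<mu>" "\<mu> < L" "\<eta> 0 = 0"
    and "\<And>k. \<eta> (Suc k) = (L * \<eta> k + 1) / (L - \<mu>)"
  shows "(\<Sum>i<k. (1 + \<mu> / L) ^ i) \<le> L * \<eta> k"
proof (induction k)
  case 0
  then show ?case using assms by simp
next
  case (Suc k)
  let ?q = "1 + \<mu> / L"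
  \<comment> \<open>The first product equals \<open>L - \<mu>\<^sup>2 / L\<close>, so
    \<open>?q\<close> does not exceed the exact growth factor
    \<open>L / (L - \<mu>)\<close>.\<close>
  have "?q * (L - \<mu>) \<le> L" "1 * (L - \<mu>) \<le> L"
    using assms(1,2) by (auto simp: field_simps)
  then have r: "?q \<le> L / (L - \<mu>)" "1 \<le> L / (L - \<mu>)"
    using assms(2) by (simp_all add: pos_le_divide_eq)
  have S: "0 \<le> (\<Sum>i<k. ?q ^ i)"
    using assms(1,2) by (intro sum_nonneg) auto
  \<comment> \<open>The Horner form of the sum mirrors the affine recursion for
    \<open>\<eta>\<close>.\<close>
  have "(\<Sum>i<Suc k. ?q ^ i) = ?q * (\<Sum>i<k. ?q ^ i) + 1"
    unfolding sum.lessThan_Suc_shift by (simp add: sum_distrib_left)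
  also have "\<dots> \<le> L / (L - \<mu>) * (L * \<eta> k) + L / (L - \<mu>)"
    using r S Suc assms(1,2) by (intro add_mono mult_mono) auto
  also have "\<dots> = L * \<eta> (Suc k)"
    unfolding assms(4) by (simp add: add_divide_distrib algebra_simps)
  finally show ?case .
qed

theorem theorem4:
  fixes d :: "real ^ 'n \<Rightarrow> ereal"
    and f :: "real ^ 'n \<Rightarrow> real"
    and L \<mu> :: real
    and x0 :: "real ^ 'n"
    and lam z x :: "nat \<Rightarrow> real ^ 'n"
    and \<eta> t :: "nat \<Rightarrow> real"
  assumes "legendre d"
    and "x0 \<in> interior (effdom d)"
    and "0 \<le> \<mu>" and "\<mu> < L"
    and "convex_on (closure (effdom d)) f"
    and "\<forall>y\<in>interior (closure (effdom d)). f differentiable (at y)"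
    and "relatively_smooth d (L - \<mu>) f"
    and "\<exists>y\<in>interior (effdom d). is_minimizer (objective d f \<mu> x0) y"
    and "\<forall>e>0. \<exists>y\<in>interior (effdom d). is_minimizer (reg_objective d f \<mu> x0 e) y"
    and "\<eta> 0 = 0" and "lam 0 = 0" and "z 0 = x0"
    and "t 0 = 1" and "1 / \<eta> 1 = L - \<mu>"
    and "\<forall>k\<ge>1. t k = (\<mu> + 1 / \<eta> k) / (L + 1 / \<eta> k)"
    and "\<forall>k\<ge>1. 1 / \<eta> (Suc k) = (1 - t k) * (1 / \<eta> k)"
    and "\<forall>k. lam (Suc k) = (1 - t k) *\<^sub>R lam k + t k *\<^sub>R grad f (z k)"
    and "\<forall>k. is_minimizer (dual_model d \<mu> x0 (\<eta> (Suc k)) (lam (Suc k))) (z (Suc k))"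
    and "\<forall>k. z (Suc k) \<in> interior (effdom d)"
    and "\<forall>k\<ge>1. is_arg_min (objective d f \<mu> x0) (\<lambda>y. y \<in> z ` {1..k}) (x k)"
  shows "implicit_envelope_descent d f \<mu> x0 \<eta> x \<and>
    (\<forall>k\<ge>1. 1 / \<eta> k \<le> L * (if \<mu> = 0 then 1 / real k
       else min (1 / real k) ((\<mu> / L) / ((1 + \<mu> / L) ^ k - 1))))"
proof -
  note d = assms(1) and x0 = assms(2) and \<mu> = assms(3) and \<mu>L = assms(4)
  have L: "0 < L" using \<mu> \<mu>L by simp
  have proper: "proper_fun d" using d by (simp add: legendre_def)
  have x0d: "x0 \<in> effdom d" using x0 interior_subset by blast
  have tk: "t k = (\<mu> + 1 / \<eta> k) / (L + 1 / \<eta> k)"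
    and e: "1 / \<eta> (Suc k) = (1 - t k) * (1 / \<eta> k)" if "1 \<le> k" for k
    using that assms(15,16) by auto
  \<comment> \<open>A positive reciprocal rules out the default \<open>1 / 0 = 0\<close>.\<close>
  have "0 < \<eta> 1" using assms(14) \<mu>L by (metis diff_gt_0_iff_gt zero_less_divide_1_iff)
  have one_minus_t: "1 - t k = (L - \<mu>) / (L + 1 / \<eta> k)" if "1 \<le> k" "0 < \<eta> k" for k
  proof -
    have "0 < L + 1 / \<eta> k" using L that by (simp add: add_pos_pos)
    then show ?thesis unfolding tk[OF that(1)] by (simp add: field_simps)
  qed
  have pos: "0 < \<eta> k" if "1 \<le> k" for k
    using that
  proof (induction k rule: nat_induct_at_least)
    case base
    show ?case by fact
  next
    case (Suc k)
    then have "0 < (1 - t k) * (1 / \<eta> k)"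
      using \<mu>L L by (simp add: one_minus_t add_pos_pos)
    then show ?case using e[OF Suc.hyps] by (metis zero_less_divide_1_iff)
  qed
  have rec: "\<eta> (Suc k) = (L * \<eta> k + 1) / (L - \<mu>)" for k
  proof (cases "k = 0")
    case True
    then show ?thesis using assms(10) by (simp flip: assms(14))
  next
    case False
    then have k: "1 \<le> k" by simp
    have "1 / \<eta> (Suc k) = (L - \<mu>) / (L * \<eta> k + 1)"
      unfolding e[OF k] one_minus_t[OF k pos[OF k]] using pos[OF k] by (simp add: distrib_right)
    then show ?thesis by (metis inverse_divide inverse_eq_divide inverse_inverse_eq)
  qed
  have t01: "0 \<le> t k \<and> t k \<le> 1" for k
  proof (cases "k = 0")
    case True
    then show ?thesis using assms(13) by simp
  next
    case False
    then have k: "1 \<le> k" by simp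
    have "0 \<le> 1 - t k"
      using one_minus_t[OF k pos[OF k]] \<mu>L L pos[OF k] by simp
    moreover have "0 \<le> t k" unfolding tk[OF k] using \<mu> L pos[OF k] by simp
    ultimately show ?thesis by simp
  qed
  \<comment> \<open>Both sides equal
    \<open>(L - \<mu>) * (\<mu> + 1 / \<eta> k) / (L + 1 / \<eta> k)\<close>.\<close>
  have balance: "(1 - t k) * (\<mu> + 1 / \<eta> k) = t k * (L - \<mu>)" if "1 \<le> k" for k
    by (subst one_minus_t[OF that pos[OF that]]) (simp add: tk[OF that])
  have weight: "\<mu> + 1 / \<eta> (Suc k) = (1 - t k) * (\<mu> + 1 / \<eta> k) + t k * \<mu>" if "1 \<le> k" for k
    unfolding e[OF that] by (simp add: algebra_simps)
  have init: "\<mu> + 1 / \<eta> 1 = L" using assms(14) by simp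

  have best: "objective d f \<mu> x0 (x k) \<le> envelope d f \<mu> x0 (\<eta> k)" if k: "1 \<le> k" for k
  proof -
    obtain i where i: "k = Suc i" using k by (cases k) auto
    have zd: "z j \<in> effdom d" if "1 \<le> j" for j
      using that assms(19) interior_subset by (cases j) auto
    have xk: "x k \<in> z ` {1..k}"
      and xmin: "\<And>j. j \<in> {1..k} \<Longrightarrow> objective d f \<mu> x0 (x k) \<le> objective d f \<mu> x0 (z j)"
      using assms(20) k by (auto simp: is_arg_min_linorder)
    have xd: "x k \<in> effdom d" using xk zd by auto
    let ?C = "f (x k) + \<mu> * real_bregman d (x k) x0"
    have C: "\<forall>j\<in>{1..k}. ?C \<le> f (z j) + \<mu> * real_bregman d (z j) x0"
      using xmin zd by (simp add: objective_eq[OF proper _ x0d] xd)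
    obtain c where minor: "\<forall>y\<in>closure (effdom d). c + y \<bullet> lam k \<le> f y"
      and "\<forall>C. (\<forall>j\<in>{1..k}. C \<le> f (z j) + \<mu> * real_bregman d (z j) x0) \<longrightarrow>
        C \<le> c + z k \<bullet> lam k + (\<mu> + 1 / \<eta> k) * real_bregman d (z k) x0"
      using dual_averaging_model[where t = t and lam = lam and z = z and \<eta> = \<eta>, OF d x0 assms(5-7)
          assms(12,13) init conjunct1[OF t01] conjunct2[OF t01] weight balance
          assms(17)[rule_format] assms(18)[rule_format] assms(19)[rule_format] k]
      by blast
    with C have Cm: "?C \<le> c + z k \<bullet> lam k + (\<mu> + 1 / \<eta> k) * real_bregman d (z k) x0" by blast
    \<comment> \<open>\<open>?C\<close> is at most the minimum of the model, hence at most the model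
      at \<open>y\<close>, which the affine minorant keeps below the regularized objective.\<close>
    have "ereal ?C \<le> reg_objective d f \<mu> x0 (\<eta> k) y" for y
    proof (cases "y \<in> effdom d")
      case True
      then have "c + y \<bullet> lam k \<le> f y" using minor closure_subset by blast
      moreover have "z k \<bullet> lam k + (\<mu> + 1 / \<eta> k) * real_bregman d (z k) x0
          \<le> y \<bullet> lam k + (\<mu> + 1 / \<eta> k) * real_bregman d y x0"
        using dual_model_minimizer[OF proper x0d True zd[OF k]] assms(18) unfolding i by blast
      ultimately show ?thesis
        using Cm by (simp add: reg_objective_eq[OF proper True x0d])
    next
      case False
      then show ?thesis
        using reg_objective_infinity[OF proper False x0d \<mu> pos[OF k]] by simp
    qed
    then show ?thesis
      unfolding envelope_def objective_eq[OF proper xd x0d] by (intro INF_greatest)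
  qed
  \<comment> \<open>The affine recursion treats \<open>k = 0\<close> together with all other
    indices.\<close>
  have mono: "\<eta> k \<le> \<eta> (Suc k)" for k
  proof -
    have "0 \<le> \<eta> k" using pos[of k] assms(10) by (cases "k = 0") auto
    then have "\<eta> k * (L - \<mu>) \<le> L * \<eta> k + 1"
      using \<mu> mult_nonneg_nonneg[of \<mu> "\<eta> k"] by (simp add: algebra_simps)
    then show ?thesis unfolding rec using \<mu>L by (simp add: pos_le_divide_eq)
  qed
  \<comment> \<open>Inverts a lower bound on \<open>L * \<eta> k\<close>; applied with
    \<open>S\<close> equal to \<open>k\<close> and to the geometric sum.\<close>
  have rate: "1 / \<eta> k \<le> L / S" if "1 \<le> k" "S \<le> L * \<eta> k" "0 < S" for k S
    using that pos[OF that(1)] by (simp add: field_simps)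
  have "1 / \<eta> k \<le> L * (if \<mu> = 0 then 1 / real k
      else min (1 / real k) ((\<mu> / L) / ((1 + \<mu> / L) ^ k - 1)))" if k: "1 \<le> k" for k
  proof -
    let ?q = "1 + \<mu> / L"
    let ?S = "\<Sum>i<k. ?q ^ i"
    have S: "?S \<le> L * \<eta> k"
      using step_parameter_lower_bound[OF \<mu> \<mu>L assms(10) rec] .
    have "(\<Sum>i<k. 1) \<le> ?S"
      using \<mu> L by (intro sum_mono one_le_power) auto
    then have kS: "real k \<le> ?S" by simp
    have linear: "1 / \<eta> k \<le> L * (1 / real k)"
      using rate[of k "real k"] k kS S by simp
    moreover have "1 / \<eta> k \<le> L * ((\<mu> / L) / (?q ^ k - 1))" if "\<mu> \<noteq> 0"
    proof -
      \<comment> \<open>The closed form requires a ratio different from 1, hence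
        \<open>\<mu> \<noteq> 0\<close>.\<close>
      have "?S = (?q ^ k - 1) / (\<mu> / L)"
        using geometric_sum[of ?q k] that L by simp
      then have "(\<mu> / L) / (?q ^ k - 1) = 1 / ?S" by simp
      then show ?thesis using rate[OF k S] kS k by simp
    qed
    ultimately show ?thesis using L by (auto simp: min_def)
  qed
  then show ?thesis
    unfolding implicit_envelope_descent_def
    using assms(10) mono pos best by simp
qed

end
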